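(* For any 3-tensor $t$ over $\mathbb{F}$ not of the form $x\otimes y\otimes z$, $$\omega(\langle 2\rangle, t)\,\omega(t,\langle 2,2,2\rangle)\geq 2\,\mathrm{irr}(t).$$
   Context: All tensors are 3-tensors over a fixed field $\mathbb{F}$, not of the form $x\otimes y\otimes z$. For $t \in \mathbb{F}^{n_1}\otimes\mathbb{F}^{n_2}\otimes\mathbb{F}^{n_3}$, $s\in \mathbb{F}^{m_1}\otimes\mathbb{F}^{m_2}\otimes\mathbb{F}^{m_3}$ write $t\geq s$ if there are linear maps $A_i:\mathbb{F}^{n_i}\to\mathbb{F}^{m_i}$ with $(A_1\otimes A_2\otimes A_3)t=s$. Tensor powers are regarded as 3-tensors by grouping factors. The relative exponent is $\omega(t,s):=\lim_{n\to\infty}\frac1n\min\{m\in\mathbb{N}: t^{\otimes m}\geq s^{\otimes n}\}$. $\langle n\rangle:=\sum_{i=1}^n e_i\otimes e_i\otimes e_i$. The irreversibility is $\mathrm{irr}(t):=\omega(\langle2\rangle,t)\,\omega(t,\langle2\rangle)$. The matrix multiplication tensor is $\langle a,b,c\rangle:=\sum_{i=1}^a\sum_{j=1}^b\sum_{k=1}^c e_{(i,j)}\otimes e_{(j,k)}\otimes e_{(k,i)} \in (\mathbb{F}^a\otimes\mathbb{F}^b)\otimes(\mathbb{F}^b\otimes\mathbb{F}^c)\otimes(\mathbb{F}^c\otimes\mathbb{F}^a)$. *)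

theory Defs
  imports "HOL-Library.Extended_Real"
begin

text \<open>
  A tensor in \<open>F^I \<otimes> F^J \<otimes> F^K\<close>, for finite index sets \<open>I\<close>, \<open>J\<close>, \<open>K\<close>, is given by its coordinates
  with respect to the standard basis. The space \<open>F^n\<close> is the case of the index set \<open>{..<n}\<close>; general
  index sets let tensor powers and matrix multiplication tensors keep their natural indexing.
  Coefficients outside the index sets carry no meaning, and no definition below depends on them.
\<close>

record ('f, 'i, 'j, 'k) tensor3 =
  idx1 :: "'i set"
  idx2 :: "'j set"
  idx3 :: "'k set"
  coeff :: "'i \<Rightarrow> 'j \<Rightarrow> 'k \<Rightarrow> 'f"

definition finite_tensor :: "('f, 'i, 'j, 'k) tensor3 \<Rightarrow> bool" where
  "finite_tensor t \<longleftrightarrow> finite (idx1 t) \<and> finite (idx2 t) \<and> finite (idx3 t)"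

text \<open>Tensors of the form \<open>x \<otimes> y \<otimes> z\<close>; the zero tensor is one of them.\<close>

definition simple_tensor :: "('f::field, 'i, 'j, 'k) tensor3 \<Rightarrow> bool" where
  "simple_tensor t \<longleftrightarrow>
    (\<exists>x y z. \<forall>i\<in>idx1 t. \<forall>j\<in>idx2 t. \<forall>k\<in>idx3 t. coeff t i j k = x i * y j * z k)"

text \<open>
  The linear maps \<open>A\<^sub>1\<close>, \<open>A\<^sub>2\<close>, \<open>A\<^sub>3\<close> are given by matrices, with \<open>A i' i\<close> the coordinate at \<open>i'\<close> of the
  image of the basis vector \<open>e i\<close>. The function below gives the coordinates of
  \<open>(A\<^sub>1 \<otimes> A\<^sub>2 \<otimes> A\<^sub>3) t = (\<Sum>i j k. t i j k \<cdot> A\<^sub>1 (e i) \<otimes> A\<^sub>2 (e j) \<otimes> A\<^sub>3 (e k))\<close>.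
\<close>

definition map_coeff ::
  "('a \<Rightarrow> 'i \<Rightarrow> 'f) \<Rightarrow> ('b \<Rightarrow> 'j \<Rightarrow> 'f) \<Rightarrow> ('c \<Rightarrow> 'k \<Rightarrow> 'f) \<Rightarrow> ('f::field, 'i, 'j, 'k) tensor3 \<Rightarrow>
    'a \<Rightarrow> 'b \<Rightarrow> 'c \<Rightarrow> 'f" where
  "map_coeff A\<^sub>1 A\<^sub>2 A\<^sub>3 t a b c =
    (\<Sum>i\<in>idx1 t. \<Sum>j\<in>idx2 t. \<Sum>k\<in>idx3 t. A\<^sub>1 a i * A\<^sub>2 b j * A\<^sub>3 c k * coeff t i j k)"

definition restricts_to ::
  "('f::field, 'i, 'j, 'k) tensor3 \<Rightarrow> ('f, 'a, 'b, 'c) tensor3 \<Rightarrow> bool" where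
  "restricts_to t s \<longleftrightarrow>
    (\<exists>A\<^sub>1 A\<^sub>2 A\<^sub>3. \<forall>a\<in>idx1 s. \<forall>b\<in>idx2 s. \<forall>c\<in>idx3 s. map_coeff A\<^sub>1 A\<^sub>2 A\<^sub>3 t a b c = coeff s a b c)"

text \<open>
  The \<open>n\<close>-th tensor power, grouped into a 3-tensor: the basis of \<open>(F^I)^{\<otimes>n}\<close> is indexed by the
  lists of length \<open>n\<close> over \<open>I\<close>.
\<close>

definition tensor_power :: "('f::field, 'i, 'j, 'k) tensor3 \<Rightarrow> nat \<Rightarrow>
    ('f, 'i list, 'j list, 'k list) tensor3" where
  "tensor_power t n =
    \<lparr>idx1 = {xs. set xs \<subseteq> idx1 t \<and> length xs = n},
     idx2 = {ys. set ys \<subseteq> idx2 t \<and> length ys = n},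
     idx3 = {zs. set zs \<subseteq> idx3 t \<and> length zs = n},
     coeff = (\<lambda>xs ys zs. \<Prod>l<n. coeff t (xs ! l) (ys ! l) (zs ! l))\<rparr>"

text \<open>
  The minimum is taken in \<^typ>\<open>enat\<close>, where the infimum of a nonempty set is its least element and
  that of the empty set is \<open>\<infinity>\<close>. The set can be empty for tensors that are not simple: no power of
  \<open>e\<^sub>0 \<otimes> (e\<^sub>0 \<otimes> e\<^sub>0 + e\<^sub>1 \<otimes> e\<^sub>1)\<close> restricts to \<open>\<langle>2\<rangle>\<close>. Hence exponents are extended reals.
\<close>

definition rel_exponent ::
  "('f::field, 'i, 'j, 'k) tensor3 \<Rightarrow> ('f, 'a, 'b, 'c) tensor3 \<Rightarrow> ereal" where
  "rel_exponent t s =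
    lim (\<lambda>n. ereal (1 / real n) *
      ereal_of_enat (INF m\<in>{m. restricts_to (tensor_power t m) (tensor_power s n)}. enat m))"

definition unit_tensor :: "nat \<Rightarrow> ('f::field, nat, nat, nat) tensor3" where
  "unit_tensor n =
    \<lparr>idx1 = {..<n}, idx2 = {..<n}, idx3 = {..<n},
     coeff = (\<lambda>i j k. if i = j \<and> j = k then 1 else 0)\<rparr>"

definition irreversibility :: "('f::field, 'i, 'j, 'k) tensor3 \<Rightarrow> ereal" where
  "irreversibility t = rel_exponent (unit_tensor 2) t * rel_exponent t (unit_tensor 2)"

definition matmult_tensor ::
  "nat \<Rightarrow> nat \<Rightarrow> nat \<Rightarrow> ('f::field, nat \<times> nat, nat \<times> nat, nat \<times> nat) tensor3" where
  "matmult_tensor a b c =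
    \<lparr>idx1 = {..<a} \<times> {..<b}, idx2 = {..<b} \<times> {..<c}, idx3 = {..<c} \<times> {..<a},
     coeff = (\<lambda>(i, j) (j', k) (k', i'). if i = i' \<and> j = j' \<and> k = k' then 1 else 0)\<rparr>"

end

theory Submission
  imports Defs "HOL-Library.FuncSet" "HOL-Real_Asymp.Real_Asymp"
begin

text \<open>
  It suffices that \<open>2 \<cdot> \<omega>(t, \<langle>2\<rangle>) \<le> \<omega>(t, \<langle>2,2,2\<rangle>)\<close>, which holds because \<open>\<langle>2,2,2\<rangle>\<^sup>n\<close> restricts to \<open>\<langle>2\<rangle>\<^sup>m\<close>
  with \<open>m = (2 - o(1)) n\<close>. Zeroing coordinates of \<open>\<langle>N,N,N\<rangle>\<close> selects edges of the complete tripartite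
  graph, and the result is diagonal if every selected edge lies in exactly one triangle; the
  Ruzsa-Szemeredi graph of Behrend's progression-free set (lattice points on a sphere) keeps
  \<open>N powr (2 - o(1))\<close> edges. Since the exponents are defined by \<^const>\<open>lim\<close>, their convergence is needed too;
  it follows from Fekete's lemma.
\<close>

section \<open>Restriction as a preorder\<close>

text \<open>Row \<open>a\<close> of the first matrix is the unit vector at \<open>g1 a\<close>, and
  likewise for the other two, so the maps merely pick out coordinates.\<close>

lemma restricts_to_reindex:
  fixes t :: "('f::field, 'i, 'j, 'k) tensor3" and s :: "('f, 'a, 'b, 'c) tensor3"
  assumes fin: "finite_tensor t"
    and g1: "\<And>a. a \<in> idx1 s \<Longrightarrow> g1 a \<in> idx1 t"
    and g2: "\<And>b. b \<in> idx2 s \<Longrightarrow> g2 b \<in> idx2 t"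
    and g3: "\<And>c. c \<in> idx3 s \<Longrightarrow> g3 c \<in> idx3 t"
    and eq: "\<And>a b c. a \<in> idx1 s \<Longrightarrow> b \<in> idx2 s \<Longrightarrow> c \<in> idx3 s \<Longrightarrow>
      coeff s a b c = coeff t (g1 a) (g2 b) (g3 c)"
  shows "restricts_to t s"
proof -
  have "map_coeff (\<lambda>a i. if i = g1 a then 1 else 0) (\<lambda>b j. if j = g2 b then 1 else 0)
      (\<lambda>c k. if k = g3 c then 1 else 0) t a b c = coeff s a b c"
    if abc: "a \<in> idx1 s" "b \<in> idx2 s" "c \<in> idx3 s" for a b c
  proof -
    have "map_coeff (\<lambda>a i. if i = g1 a then 1 else 0) (\<lambda>b j. if j = g2 b then 1 else 0)
        (\<lambda>c k. if k = g3 c then 1 else 0) t a b c =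
      (\<Sum>i\<in>idx1 t. if i = g1 a then (\<Sum>j\<in>idx2 t. if j = g2 b then
        (\<Sum>k\<in>idx3 t. if k = g3 c then coeff t i j k else 0) else 0) else 0)"
      unfolding map_coeff_def by (intro sum.cong refl) (auto intro!: sum.cong)
    also have "\<dots> = coeff s a b c"
      using fin g1[OF abc(1)] g2[OF abc(2)] g3[OF abc(3)] eq[OF abc]
      by (simp add: finite_tensor_def)
    finally show ?thesis .
  qed
  then show ?thesis
    unfolding restricts_to_def by blast
qed

lemma restricts_to_refl: "finite_tensor t \<Longrightarrow> restricts_to t t"
  by (rule restricts_to_reindex[where ?g1.0 = id and ?g2.0 = id and ?g3.0 = id]) auto

lemma map_coeff_triples:
  "map_coeff A B C t a b c =
    (\<Sum>(i, j, k)\<in>idx1 t \<times> idx2 t \<times> idx3 t. A a i * B b j * C c k * coeff t i j k)"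
  unfolding map_coeff_def by (simp add: sum.cartesian_product)

text \<open>Restrictions compose: \<open>C1\<close>, \<open>C2\<close>, \<open>C3\<close> are the
  matrix products of the \<open>B\<close> and \<open>A\<close> matrices, and the claim reduces to an
  exchange of finite sums.\<close>

lemma restricts_to_trans:
  assumes "restricts_to t s" and "restricts_to s r"
  shows "restricts_to t r"
proof -
  obtain A1 A2 A3 where A: "\<And>a b c. a \<in> idx1 s \<Longrightarrow> b \<in> idx2 s \<Longrightarrow> c \<in> idx3 s \<Longrightarrow>
      map_coeff A1 A2 A3 t a b c = coeff s a b c"
    using assms(1) unfolding restricts_to_def by blast
  obtain B1 B2 B3 where B: "\<And>a b c. a \<in> idx1 r \<Longrightarrow> b \<in> idx2 r \<Longrightarrow> c \<in> idx3 r \<Longrightarrow>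
      map_coeff B1 B2 B3 s a b c = coeff r a b c"
    using assms(2) unfolding restricts_to_def by blast
  define C1 where "C1 a i = (\<Sum>x\<in>idx1 s. B1 a x * A1 x i)" for a i
  define C2 where "C2 a i = (\<Sum>x\<in>idx2 s. B2 a x * A2 x i)" for a i
  define C3 where "C3 a i = (\<Sum>x\<in>idx3 s. B3 a x * A3 x i)" for a i
  let ?S = "idx1 s \<times> idx2 s \<times> idx3 s" and ?T = "idx1 t \<times> idx2 t \<times> idx3 t"
  have "map_coeff C1 C2 C3 t a b c = coeff r a b c"
    if abc: "a \<in> idx1 r" "b \<in> idx2 r" "c \<in> idx3 r" for a b c
  proof -
    let ?B = "\<lambda>x y z. B1 a x * B2 b y * B3 c z"
    let ?A = "\<lambda>x y z i j k. A1 x i * A2 y j * A3 z k * coeff t i j k"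
    have C: "C1 a i * C2 b j * C3 c k * coeff t i j k =
        (\<Sum>(x, y, z)\<in>?S. ?B x y z * ?A x y z i j k)" for i j k
    proof -
      \<comment> \<open>The bracketing makes \<open>sum_product\<close> nest the sums in the order
        \<open>x\<close>, \<open>y\<close>, \<open>z\<close>.\<close>
      have "C1 a i * (C2 b j * C3 c k) * coeff t i j k = (\<Sum>x\<in>idx1 s. \<Sum>y\<in>idx2 s. \<Sum>z\<in>idx3 s.
          B1 a x * A1 x i * ((B2 b y * A2 y j) * (B3 c z * A3 z k)) * coeff t i j k)"
        by (simp only: C1_def C2_def C3_def sum_product) (simp only: sum_distrib_left sum_distrib_right)
      then show ?thesis
        by (simp add: sum.cartesian_product mult_ac)
    qed
    have "map_coeff C1 C2 C3 t a b c =
        (\<Sum>(i, j, k)\<in>?T. \<Sum>(x, y, z)\<in>?S. ?B x y z * ?A x y z i j k)"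
      unfolding map_coeff_triples C ..
    also have "\<dots> = (\<Sum>(x, y, z)\<in>?S. \<Sum>(i, j, k)\<in>?T. ?B x y z * ?A x y z i j k)"
      unfolding case_prod_unfold by (rule sum.swap)
    also have "\<dots> = (\<Sum>(x, y, z)\<in>?S. ?B x y z * map_coeff A1 A2 A3 t x y z)"
      unfolding map_coeff_triples sum_distrib_left case_prod_unfold ..
    also have "\<dots> = (\<Sum>(x, y, z)\<in>?S. ?B x y z * coeff s x y z)"
      by (intro sum.cong) (auto simp: A)
    also have "\<dots> = coeff r a b c"
      using B[OF abc] by (simp add: map_coeff_triples)
    finally show ?thesis .
  qed
  then show ?thesis
    unfolding restricts_to_def by blast
qed

section \<open>Restrictions between tensor powers\<close>

lemma finite_tensor_power: "finite_tensor t \<Longrightarrow> finite_tensor (tensor_power t n)"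
  by (auto simp: finite_tensor_def tensor_power_def intro: finite_lists_length_eq)

lemma sum_lists_append:
  "(\<Sum>xs\<in>{xs. set xs \<subseteq> X \<and> length xs = m + n}. f xs) =
    (\<Sum>u\<in>{xs. set xs \<subseteq> X \<and> length xs = m}. \<Sum>v\<in>{xs. set xs \<subseteq> X \<and> length xs = n}. f (u @ v))"
proof -
  have "bij_betw (\<lambda>(u, v). u @ v)
      ({xs. set xs \<subseteq> X \<and> length xs = m} \<times> {xs. set xs \<subseteq> X \<and> length xs = n})
      {xs. set xs \<subseteq> X \<and> length xs = m + n}"
    by (rule bij_betw_byWitness[where f' = "\<lambda>xs. (take m xs, drop m xs)"])
      (auto dest: in_set_takeD in_set_dropD)
  then show ?thesis
    by (simp add: sum.reindex_bij_betw[symmetric] sum.cartesian_product case_prod_unfold)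
qed

text \<open>Up to concatenation of index lists, the power \<open>m + n\<close> is the tensor product
  of the powers \<open>m\<close> and \<open>n\<close>.\<close>

lemma coeff_tensor_power_append:
  fixes t :: "('f::field, 'i, 'j, 'k) tensor3"
  assumes "length u = m" "length v = m" "length w = m"
  shows "coeff (tensor_power t (m + n)) (u @ u') (v @ v') (w @ w') =
    coeff (tensor_power t m) u v w * coeff (tensor_power t n) u' v' w'"
proof -
  have split: "(\<Prod>l<m + n. h l) = (\<Prod>l<m. h l) * (\<Prod>l<n. h (m + l))" for h :: "nat \<Rightarrow> 'f"
    by (induction n) (auto simp: mult_ac)
  show ?thesis
    using assms by (simp add: tensor_power_def split nth_append)
qed

text \<open>Two restrictions are tensored: each new matrix is a Kronecker product, its target index
  cut after \<open>n\<close> entries and its source index after \<open>m\<close>. This will make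
  costs subadditive.\<close>

lemma restricts_to_power_add:
  assumes "restricts_to (tensor_power t m) (tensor_power s n)"
    and "restricts_to (tensor_power t m') (tensor_power s n')"
  shows "restricts_to (tensor_power t (m + m')) (tensor_power s (n + n'))"
proof -
  obtain A1 A2 A3 where A: "\<And>a b c. a \<in> idx1 (tensor_power s n) \<Longrightarrow> b \<in> idx2 (tensor_power s n) \<Longrightarrow>
      c \<in> idx3 (tensor_power s n) \<Longrightarrow>
      map_coeff A1 A2 A3 (tensor_power t m) a b c = coeff (tensor_power s n) a b c"
    using assms(1) unfolding restricts_to_def by blast
  obtain B1 B2 B3 where B: "\<And>a b c. a \<in> idx1 (tensor_power s n') \<Longrightarrow> b \<in> idx2 (tensor_power s n') \<Longrightarrow>
      c \<in> idx3 (tensor_power s n') \<Longrightarrow>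
      map_coeff B1 B2 B3 (tensor_power t m') a b c = coeff (tensor_power s n') a b c"
    using assms(2) unfolding restricts_to_def by blast
  define C1 where "C1 xs ys = A1 (take n xs) (take m ys) * B1 (drop n xs) (drop m ys)" for xs ys
  define C2 where "C2 xs ys = A2 (take n xs) (take m ys) * B2 (drop n xs) (drop m ys)" for xs ys
  define C3 where "C3 xs ys = A3 (take n xs) (take m ys) * B3 (drop n xs) (drop m ys)" for xs ys
  have "map_coeff C1 C2 C3 (tensor_power t (m + m')) a b c =
      coeff (tensor_power s (n + n')) a b c"
    if abc: "a \<in> idx1 (tensor_power s (n + n'))" "b \<in> idx2 (tensor_power s (n + n'))"
      "c \<in> idx3 (tensor_power s (n + n'))" for a b c
  proof -
    let ?F = "\<lambda>u v w. A1 (take n a) u * A2 (take n b) v * A3 (take n c) w * coeff (tensor_power t m) u v w"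
    let ?G = "\<lambda>u v w. B1 (drop n a) u * B2 (drop n b) v * B3 (drop n c) w * coeff (tensor_power t m') u v w"
    let ?L = "\<lambda>X k. {xs. set xs \<subseteq> X \<and> length xs = k}"
    have idx: "idx1 (tensor_power t k) = ?L (idx1 t) k" "idx2 (tensor_power t k) = ?L (idx2 t) k"
      "idx3 (tensor_power t k) = ?L (idx3 t) k" for k
      by (simp_all add: tensor_power_def)
    have "map_coeff C1 C2 C3 (tensor_power t (m + m')) a b c =
      (\<Sum>u\<in>?L (idx1 t) m. \<Sum>u'\<in>?L (idx1 t) m'. \<Sum>v\<in>?L (idx2 t) m. \<Sum>v'\<in>?L (idx2 t) m'.
        \<Sum>w\<in>?L (idx3 t) m. \<Sum>w'\<in>?L (idx3 t) m'. ?F u v w * ?G u' v' w')"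
      unfolding map_coeff_def idx sum_lists_append
      by (intro sum.cong refl) (simp add: coeff_tensor_power_append C1_def C2_def C3_def mult_ac)
    also have "\<dots> = map_coeff A1 A2 A3 (tensor_power t m) (take n a) (take n b) (take n c) *
        map_coeff B1 B2 B3 (tensor_power t m') (drop n a) (drop n b) (drop n c)"
      unfolding map_coeff_def idx sum_product ..
    also have "\<dots> = coeff (tensor_power s n) (take n a) (take n b) (take n c) *
        coeff (tensor_power s n') (drop n a) (drop n b) (drop n c)"
      using abc
      by (intro arg_cong2[where f = "(*)"] A B) (auto simp: tensor_power_def dest: in_set_takeD in_set_dropD)
    also have "\<dots> = coeff (tensor_power s (n + n')) (take n a @ drop n a) (take n b @ drop n b)
        (take n c @ drop n c)"
      using abc by (intro coeff_tensor_power_append[symmetric]) (auto simp: tensor_power_def)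
    finally show ?thesis
      by simp
  qed
  then show ?thesis
    unfolding restricts_to_def by blast
qed

lemma restricts_to_power_0: "restricts_to (tensor_power t 0) (tensor_power s 0)"
  by (rule restricts_to_reindex[where ?g1.0 = "\<lambda>_. []" and ?g2.0 = "\<lambda>_. []" and ?g3.0 = "\<lambda>_. []"])
    (auto simp: tensor_power_def finite_tensor_def)

lemma restricts_to_power_mult:
  "restricts_to (tensor_power t m) (tensor_power s n) \<Longrightarrow>
    restricts_to (tensor_power t (m * k)) (tensor_power s (n * k))"
  by (induction k) (auto intro: restricts_to_power_add restricts_to_power_0)

text \<open>Reading off a nonzero coefficient, scaled to 1, maps one factor to the scalar 1, which
  is the zeroth power; the identity acts on the other \<open>n\<close> factors. This will make costs
  monotone.\<close>

lemma restricts_to_power_Suc: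
  assumes "finite_tensor s" and ijk: "i \<in> idx1 s" "j \<in> idx2 s" "k \<in> idx3 s" "coeff s i j k \<noteq> 0"
  shows "restricts_to (tensor_power s (Suc n)) (tensor_power s n)"
proof -
  have one: "{xs. set xs \<subseteq> X \<and> length xs = Suc 0} = (\<lambda>x. [x]) ` X" for X :: "'x set"
    by (auto simp: length_Suc_conv)
  have "map_coeff (\<lambda>_ xs. if xs = [i] then 1 / coeff s i j k else 0)
      (\<lambda>_ xs. if xs = [j] then 1 else 0) (\<lambda>_ xs. if xs = [k] then 1 else 0)
      (tensor_power s 1) [] [] [] =
    (\<Sum>x\<in>idx1 s. if x = i then (\<Sum>y\<in>idx2 s. if y = j then
        (\<Sum>z\<in>idx3 s. if z = k then coeff s x y z / coeff s i j k else 0) else 0) else 0)"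
    unfolding map_coeff_def tensor_power_def
    by (simp add: one sum.reindex inj_on_def) (intro sum.cong refl, auto intro!: sum.cong)
  also have "\<dots> = 1"
    using assms by (simp add: finite_tensor_def)
  finally have "restricts_to (tensor_power s 1) (tensor_power s 0)"
    unfolding restricts_to_def
    by (intro exI[of _ "\<lambda>_ xs. if xs = [i] then 1 / coeff s i j k else 0"]
        exI[of _ "\<lambda>_ xs. if xs = [j] then 1 else 0"] exI[of _ "\<lambda>_ xs. if xs = [k] then 1 else 0"])
      (auto simp: tensor_power_def)
  from restricts_to_power_add[OF this restricts_to_refl[OF finite_tensor_power[OF assms(1)]], of n]
  show ?thesis
    by simp
qed

section \<open>Fekete's lemma and convergence of the exponents\<close>

text \<open>Fekete's lemma; in the finite case the limit is the infimum of the quotients.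
  Monotonicity allows rounding \<open>n\<close> up to a multiple of \<open>m\<close>, and makes all
  values from 1 on infinite once \<open>f 1\<close> is.\<close>

lemma enat_subadditive_quotient_convergent:
  fixes f :: "nat \<Rightarrow> enat"
  assumes sub: "\<And>m n. f (m + n) \<le> f m + f n" and mono: "mono f" and "f 0 = 0"
  shows "convergent (\<lambda>n. ereal (1 / real n) * ereal_of_enat (f n))"
proof (cases "f 1 = \<infinity>")
  case True
  have "f n = \<infinity>" if "n \<ge> 1" for n
    using monoD[OF mono that] True by simp
  then have "\<forall>\<^sub>F n in sequentially. ereal (1 / real n) * ereal_of_enat (f n) = \<infinity>"
    by (intro eventually_sequentiallyI[of 1]) auto
  then show ?thesis
    unfolding convergent_def by (intro exI tendsto_eventually)
next
  case False
  have mult: "f (m * n) \<le> of_nat n * f m" for m n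
  proof (induction n)
    case (Suc n)
    have "f (m * Suc n) \<le> f m + f (m * n)"
      using sub[of m "m * n"] by simp
    also have "\<dots> \<le> f m + of_nat n * f m"
      using Suc by (intro add_mono) auto
    finally show ?case
      by (simp add: distrib_right)
  qed (simp add: assms)
  have "f n \<noteq> \<infinity>" for n
    using mult[of 1 n] False by (cases "f 1") (auto simp: of_nat_eq_enat dest: enat_ile)
  then have "\<exists>k. f n = enat k" for n
    by auto
  then obtain g where g: "\<And>n. f n = enat (g n)"
    by metis
  have gmult: "g (m * n) \<le> n * g m" for m n
    using mult[of m n] by (simp add: g of_nat_eq_enat)
  have gmono: "g m \<le> g n" if "m \<le> n" for m n
    using monoD[OF mono that] by (simp add: g)
  \<comment> \<open>Index 0 is left out because division by zero would give it the quotient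
    0.\<close>
  define L where "L = (INF n\<in>{1..}. real (g n) / real n)"
  have bdd: "bdd_below ((\<lambda>n. real (g n) / real n) ` {1..})"
    by (intro bdd_belowI2[of _ 0]) auto
  have "(\<lambda>n. real (g n) / real n) \<longlonglongrightarrow> L"
  proof (rule tendstoI)
    fix e :: real
    assume "e > 0"
    then obtain m where m: "m \<ge> 1" "real (g m) / real m < L + e / 2"
      using cINF_less_iff[OF _ bdd, of "L + e / 2"] by (auto simp: L_def)
    have "(\<lambda>n. real (g m) / real n) \<longlonglongrightarrow> 0"
      by real_asymp
    then have "\<forall>\<^sub>F n in sequentially. real (g m) / real n < e / 2"
      using \<open>e > 0\<close> by (intro order_tendstoD) auto
    then show "\<forall>\<^sub>F n in sequentially. dist (real (g n) / real n) L < e"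
      using eventually_ge_at_top[of 1]
    proof eventually_elim
      case (elim n)
      \<comment> \<open>Rounding \<open>n\<close> up to a multiple of \<open>m\<close> costs at most
        \<open>g m / n\<close> in the quotient, which is below \<open>e / 2\<close> here.\<close>
      have "n \<le> m * (n div m + 1)"
        using m(1) by (simp add: dividend_less_times_div less_imp_le)
      then have "g n \<le> (n div m + 1) * g m"
        using gmono gmult order_trans by blast
      then have "real (g n) \<le> (real (n div m) + 1) * real (g m)"
        by (metis of_nat_1 of_nat_add of_nat_le_iff of_nat_mult)
      also have "\<dots> \<le> (real n / real m + 1) * real (g m)"
        by (intro mult_right_mono add_right_mono of_nat_div_le_of_nat) auto
      finally have "real (g n) / real n \<le> real (g m) / real m + real (g m) / real n"
        using elim m(1) by (simp add: field_simps)
      moreover have "L \<le> real (g n) / real n"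
        unfolding L_def using elim by (intro cINF_lower bdd) auto
      ultimately show ?case
        using elim(1) m(2) unfolding dist_real_def by linarith
    qed
  qed
  then have "(\<lambda>n. ereal (1 / real n) * ereal_of_enat (f n)) \<longlonglongrightarrow> ereal L"
    by (simp add: g)
  then show ?thesis
    by (auto simp: convergent_def)
qed

text \<open>This is the infimum inside \<open>rel_exponent\<close>, named so that it can be
  estimated before passing to the limit.\<close>

definition power_cost ::
  "('f::field, 'i, 'j, 'k) tensor3 \<Rightarrow> ('f, 'a, 'b, 'c) tensor3 \<Rightarrow> nat \<Rightarrow> enat" where
  "power_cost t s n = (INF m\<in>{m. restricts_to (tensor_power t m) (tensor_power s n)}. enat m)"

lemma power_cost_le: "restricts_to (tensor_power t m) (tensor_power s n) \<Longrightarrow> power_cost t s n \<le> enat m"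
  unfolding power_cost_def by (auto intro: INF_lower)

text \<open>The extended naturals are well-ordered, so a finite cost comes with an actual
  restriction.\<close>

lemma power_cost_attained:
  assumes "power_cost t s n \<noteq> \<infinity>"
  obtains m where "power_cost t s n = enat m" "restricts_to (tensor_power t m) (tensor_power s n)"
proof -
  have "enat ` {m. restricts_to (tensor_power t m) (tensor_power s n)} \<noteq> {}"
    using assms unfolding power_cost_def Inf_enat_def by metis
  then have "power_cost t s n \<in> enat ` {m. restricts_to (tensor_power t m) (tensor_power s n)}"
    unfolding power_cost_def by (metis Inf_enat_def LeastI_ex ex_in_conv)
  then show ?thesis
    using that by auto
qed

text \<open>By transitivity the set of admissible \<open>m\<close> only grows. This serves both
  monotonicity in the exponent and the comparison of different targets.\<close>

lemma power_cost_anti: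
  assumes "restricts_to (tensor_power s n) (tensor_power r k)"
  shows "power_cost t r k \<le> power_cost t s n"
  unfolding power_cost_def using restricts_to_trans[OF _ assms] by (intro INF_superset_mono) auto

text \<open>\<open>lim\<close> says nothing until convergence is known, so estimates of exponents
  start here. The nonzero coefficient supplies the monotonicity for Fekete's lemma.\<close>

lemma rel_exponent_LIMSEQ:
  assumes "finite_tensor s" and "i \<in> idx1 s" "j \<in> idx2 s" "k \<in> idx3 s" "coeff s i j k \<noteq> 0"
  shows "(\<lambda>n. ereal (1 / real n) * ereal_of_enat (power_cost t s n)) \<longlonglongrightarrow> rel_exponent t s"
proof -
  have "convergent (\<lambda>n. ereal (1 / real n) * ereal_of_enat (power_cost t s n))"
  proof (rule enat_subadditive_quotient_convergent)
    show "power_cost t s (m + n) \<le> power_cost t s m + power_cost t s n" for m n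
    proof (cases "power_cost t s m = \<infinity> \<or> power_cost t s n = \<infinity>")
      case False
      then obtain a b where "power_cost t s m = enat a" "restricts_to (tensor_power t a) (tensor_power s m)"
        "power_cost t s n = enat b" "restricts_to (tensor_power t b) (tensor_power s n)"
        by (metis power_cost_attained)
      then show ?thesis
        using power_cost_le[OF restricts_to_power_add] by (metis plus_enat_simps(1))
    qed auto
    show "mono (power_cost t s)"
      unfolding mono_iff_le_Suc by (intro allI power_cost_anti restricts_to_power_Suc[OF assms])
    show "power_cost t s 0 = 0"
      using power_cost_le[OF restricts_to_power_0, of t s] by (simp add: zero_enat_def[symmetric])
  qed
  then show ?thesis
    unfolding rel_exponent_def power_cost_def[symmetric] by (simp add: convergent_LIMSEQ_iff)
qed

section \<open>Diagonal tensors from triangle systems\<close>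

text \<open>Each \<open>p\<close> in \<open>P\<close> is a triangle with vertices
  \<open>I p\<close>, \<open>J p\<close>, \<open>K p\<close> in three copies of \<open>V\<close>,
  and its edges index the three tensor factors. By \<open>uniq\<close> the selected edges close up
  only to the given triangles, so the selected subtensor is diagonal.\<close>

lemma matmult_power_restricts_to_unit_power:
  fixes I J K :: "'p \<Rightarrow> 'v"
  assumes V: "finite V" "card V \<le> 2 ^ n" and P: "finite P" "2 ^ N \<le> card P"
    and IJK: "\<And>p. p \<in> P \<Longrightarrow> I p \<in> V \<and> J p \<in> V \<and> K p \<in> V"
    and uniq: "\<And>p q r. p \<in> P \<Longrightarrow> q \<in> P \<Longrightarrow> r \<in> P \<Longrightarrow> I p = I r \<Longrightarrow> J p = J q \<Longrightarrow> K q = K r \<Longrightarrow>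
      p = q \<and> q = r"
  shows "restricts_to (tensor_power (matmult_tensor 2 2 2 :: ('f::field, _, _, _) tensor3) n)
    (tensor_power (unit_tensor 2) N)"
proof -
  let ?L = "\<lambda>n. {xs. set xs \<subseteq> {..<2::nat} \<and> length xs = n}"
  have L: "finite (?L k)" "card (?L k) = 2 ^ k" for k
    by (simp_all add: finite_lists_length_eq card_lists_length_eq)
  \<comment> \<open>\<open>e\<close> writes vertices as binary words of length \<open>n\<close>;
    \<open>h\<close> picks \<open>2 ^ N\<close> triangles, labelled by the index words of the unit
    tensor power.\<close>
  obtain e where e: "e ` V \<subseteq> ?L n" "inj_on e V"
    using card_le_inj[OF V(1) L(1), of n] V(2) L(2) by auto
  obtain h where h: "h ` ?L N \<subseteq> P" "inj_on h (?L N)"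
    using card_le_inj[OF L(1) P(1), of N] P(2) L(2) by auto
  \<comment> \<open>An edge becomes a list of pairs, the form of an index of the matrix
    multiplication power.\<close>
  define g where "g A B xs = zip (e (A (h xs))) (e (B (h xs)))" for A B xs
  have hP: "h xs \<in> P" if "xs \<in> ?L N" for xs
    using h that by blast
  have eL: "e v \<in> ?L n" if "v \<in> V" for v
    using e that by blast
  have elen: "length (e v) = n" if "v \<in> V" for v
    using eL[OF that] by simp
  have gL: "set (g A B xs) \<subseteq> {..<2} \<times> {..<2} \<and> length (g A B xs) = n"
    if "A (h xs) \<in> V" "B (h xs) \<in> V" for A B xs
    using eL[OF that(1)] eL[OF that(2)]
    by (auto simp: g_def dest: set_zip_leftD set_zip_rightD)
  have prod01: "(\<Prod>l<k. if Q l then 1 else 0 :: 'f) = (if \<forall>l<k. Q l then 1 else 0)" for Q and k :: nat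
    by (induction k) (auto simp: less_Suc_eq)
  show ?thesis
  proof (rule restricts_to_reindex[where ?g1.0 = "g I J" and ?g2.0 = "g J K" and ?g3.0 = "g K I"])
    show "finite_tensor (tensor_power (matmult_tensor 2 2 2) n)"
      by (intro finite_tensor_power) (simp add: finite_tensor_def matmult_tensor_def)
  next
    fix xs ys zs
    assume "xs \<in> idx1 (tensor_power (unit_tensor 2 :: ('f, _, _, _) tensor3) N)"
      and "ys \<in> idx2 (tensor_power (unit_tensor 2 :: ('f, _, _, _) tensor3) N)"
      and "zs \<in> idx3 (tensor_power (unit_tensor 2 :: ('f, _, _, _) tensor3) N)"
    then have L: "xs \<in> ?L N" "ys \<in> ?L N" "zs \<in> ?L N"
      by (simp_all add: tensor_power_def unit_tensor_def)
    note P = hP[OF L(1)] hP[OF L(2)] hP[OF L(3)]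
    note V = IJK[OF P(1)] IJK[OF P(2)] IJK[OF P(3)]
    have nth_eq: "(\<forall>l<n. e u ! l = e v ! l) \<longleftrightarrow> u = v" if "u \<in> V" "v \<in> V" for u v
    proof -
      have "(\<forall>l<n. e u ! l = e v ! l) \<longleftrightarrow> e u = e v"
        using that by (simp add: elen list_eq_iff_nth_eq)
      then show ?thesis
        using that by (simp add: inj_on_eq_iff[OF e(2)])
    qed
    \<comment> \<open>The coefficient tests whether an \<open>I\<close>-\<open>J\<close>, a
      \<open>J\<close>-\<open>K\<close> and a \<open>K\<close>-\<open>I\<close> edge, taken from
      three chosen triangles, share their endpoints.\<close>
    have "coeff (tensor_power (matmult_tensor 2 2 2 :: ('f, _, _, _) tensor3) n) (g I J xs) (g J K ys) (g K I zs) =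
      (\<Prod>l<n. if e (I (h xs)) ! l = e (I (h zs)) ! l \<and> e (J (h xs)) ! l = e (J (h ys)) ! l \<and>
        e (K (h ys)) ! l = e (K (h zs)) ! l then 1 else 0)"
      unfolding tensor_power_def matmult_tensor_def g_def tensor3.simps
      by (intro prod.cong refl) (use V in \<open>simp add: elen\<close>)
    also have "\<dots> = (if I (h xs) = I (h zs) \<and> J (h xs) = J (h ys) \<and> K (h ys) = K (h zs) then 1 else 0)"
      using V by (simp add: prod01 nth_eq all_conj_distrib imp_conjR)
    also have "\<dots> = (if xs = ys \<and> ys = zs then 1 else 0)"
    proof -
      have "I (h xs) = I (h zs) \<and> J (h xs) = J (h ys) \<and> K (h ys) = K (h zs) \<longleftrightarrow>
          h xs = h ys \<and> h ys = h zs"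
        using uniq[OF P] by metis
      then show ?thesis
        using L by (simp only: inj_on_eq_iff[OF h(2)])
    qed
    also have "\<dots> = coeff (tensor_power (unit_tensor 2 :: ('f, _, _, _) tensor3) N) xs ys zs"
      using L by (auto simp: tensor_power_def unit_tensor_def prod01 list_eq_iff_nth_eq)
    finally show "coeff (tensor_power (unit_tensor 2 :: ('f, _, _, _) tensor3) N) xs ys zs =
      coeff (tensor_power (matmult_tensor 2 2 2) n) (g I J xs) (g J K ys) (g K I zs)" ..
  qed (use gL hP IJK in \<open>simp_all add: tensor_power_def matmult_tensor_def unit_tensor_def\<close>)
qed

section \<open>Behrend's construction\<close>

text \<open>Pigeonhole: the squared length takes at most \<open>K * D\<^sup>2 + 1\<close> values on
  the cube, and \<open>r\<close> is a most frequent one.\<close>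

lemma ex_large_sphere:
  fixes K D :: nat
  obtains r where
    "D ^ K \<le> card {a \<in> {..<K} \<rightarrow>\<^sub>E {..<D}. (\<Sum>l<K. (a l)\<^sup>2) = r} * (K * D\<^sup>2 + 1)"
proof -
  let ?A = "{..<K} \<rightarrow>\<^sub>E {..<D}" and ?q = "\<lambda>a. \<Sum>l<K. (a l)\<^sup>2"
  let ?c = "\<lambda>r. card {a \<in> ?A. ?q a = r}"
  have q: "?q a \<le> K * D\<^sup>2" if "a \<in> ?A" for a
    using sum_bounded_above[of "{..<K}" "\<lambda>l. (a l)\<^sup>2" "D\<^sup>2"] that
    by (auto intro!: power_mono simp: PiE_iff less_imp_le)
  have fin: "finite ?A"
    by (intro finite_PiE) auto
  have "card ?A = (\<Sum>r\<le>K * D\<^sup>2. ?c r)"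
    using sum.group[OF fin finite_atMost image_subsetI, of ?q "K * D\<^sup>2" "\<lambda>_. 1 :: nat"] q by simp
  moreover have "Max (?c ` {..K * D\<^sup>2}) \<in> ?c ` {..K * D\<^sup>2}"
    by (intro Max_in) auto
  then obtain r where r: "Max (?c ` {..K * D\<^sup>2}) = ?c r"
    by blast
  have "(\<Sum>r\<le>K * D\<^sup>2. ?c r) \<le> of_nat (card {..K * D\<^sup>2}) * ?c r"
    unfolding r[symmetric] by (intro sum_bounded_above Max_ge) auto
  ultimately have "D ^ K \<le> ?c r * (K * D\<^sup>2 + 1)"
    by (simp add: card_PiE algebra_simps)
  then show ?thesis
    using that by blast
qed

text \<open>
  The parallelogram law: \<open>\<Sum>(a - b)\<^sup>2 = 2\<Sum>a\<^sup>2 + 2\<Sum>b\<^sup>2 - \<Sum>(a + b)\<^sup>2 = 2r + 2r - 4r = 0\<close>.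
\<close>

lemma sphere_midpoint_unique:
  fixes a b c :: "nat \<Rightarrow> nat"
  assumes r: "(\<Sum>l<K. (a l)\<^sup>2) = r" "(\<Sum>l<K. (b l)\<^sup>2) = r" "(\<Sum>l<K. (c l)\<^sup>2) = r"
    and mid: "\<And>l. l < K \<Longrightarrow> a l + b l = 2 * c l" and "l < K"
  shows "a l = b l"
proof -
  \<comment> \<open>The argument moves to the integers, since subtraction of naturals
    truncates.\<close>
  have R: "(\<Sum>l<K. (int (a l))\<^sup>2) = int r" "(\<Sum>l<K. (int (b l))\<^sup>2) = int r"
    "(\<Sum>l<K. (int (c l))\<^sup>2) = int r"
    using r by (simp_all flip: of_nat_power of_nat_sum)
  have "(int (a l) - int (b l))\<^sup>2 = 2 * (int (a l))\<^sup>2 + 2 * (int (b l))\<^sup>2 - 4 * (int (c l))\<^sup>2"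
    if "l < K" for l
  proof -
    have "int (a l) + int (b l) = 2 * int (c l)"
      using mid[OF that] by linarith
    then have "(int (a l) + int (b l))\<^sup>2 = 4 * (int (c l))\<^sup>2"
      by simp
    then show ?thesis
      by (simp add: power2_eq_square algebra_simps)
  qed
  then have "(\<Sum>l<K. (int (a l) - int (b l))\<^sup>2) =
      2 * (\<Sum>l<K. (int (a l))\<^sup>2) + 2 * (\<Sum>l<K. (int (b l))\<^sup>2) - 4 * (\<Sum>l<K. (int (c l))\<^sup>2)"
    by (simp add: sum.distrib sum_subtractf sum_distrib_left)
  also have "\<dots> = 0"
    by (simp add: R)
  finally show ?thesis
    using \<open>l < K\<close> by (simp add: sum_nonneg_eq_0_iff)
qed

text \<open>
  With \<open>D = 2 ^ p\<close>, a pair of \<open>x\<close> and \<open>a\<close> in the cube \<open>[0, D)\<^sup>K\<close>, where \<open>a\<close> lies on a fixed sphere, gives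
  the triangle \<open>x\<close>, \<open>x + a\<close>, \<open>x + 2a\<close> in \<open>[0, 4D)\<^sup>K\<close>. An edge determines the difference \<open>a\<close>, and a
  triangle with edges from three such triangles satisfies \<open>a + b = 2c\<close>.
\<close>

lemma matmult_power_restricts_to_unit_power_Behrend:
  assumes "p \<ge> 1" and K: "K * (2 ^ p)\<^sup>2 + 1 \<le> 2 ^ K"
  shows "restricts_to (tensor_power (matmult_tensor 2 2 2 :: ('f::field, _, _, _) tensor3) ((p + 2) * K))
    (tensor_power (unit_tensor 2) ((2 * p - 1) * K))"
proof -
  define D :: nat where "D = 2 ^ p"
  let ?A = "{..<K} \<rightarrow>\<^sub>E {..<D}"
  obtain r where r: "D ^ K \<le> card {a \<in> ?A. (\<Sum>l<K. (a l)\<^sup>2) = r} * (K * D\<^sup>2 + 1)"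
    by (rule ex_large_sphere)
  define S where "S = {a \<in> ?A. (\<Sum>l<K. (a l)\<^sup>2) = r}"
  \<comment> \<open>The triangle's vertices are \<open>mv 0\<close>, \<open>mv 1\<close> and
    \<open>mv 2\<close>. Restricting to \<open>{..<K}\<close> keeps them in the extensional function
    space.\<close>
  define mv where "mv k = (\<lambda>(x, a). \<lambda>l\<in>{..<K}. x l + k * a l)"
    for k :: nat
  have fin: "finite ?A" "finite S"
    by (auto simp: S_def intro!: finite_PiE)
  have pK: "p * K = (p - 1) * K + K"
    using \<open>p \<ge> 1\<close> by (cases p) auto
  \<comment> \<open>The assumption on \<open>K\<close> bounds the pigeonhole loss by
    \<open>2 ^ K\<close>, which is one factor 2 per coordinate of \<open>D ^ K\<close>.\<close>
  have "2 ^ ((p - 1) * K) * 2 ^ K \<le> card S * 2 ^ K"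
    using order_trans[OF r mult_left_mono[OF K[folded D_def] le0]]
    by (simp add: D_def S_def pK power_add flip: power_mult)
  then have S: "2 ^ ((p - 1) * K) \<le> card S"
    by simp
  have exp: "(2 * p - 1) * K = p * K + (p - 1) * K"
    using \<open>p \<ge> 1\<close> by (cases p) (auto simp: algebra_simps)
  show ?thesis
  proof (rule matmult_power_restricts_to_unit_power
      [where V = "{..<K} \<rightarrow>\<^sub>E {..<4 * D}" and P = "?A \<times> S" and I = "mv 0" and J = "mv 1" and K = "mv 2"])
    show "finite ({..<K} \<rightarrow>\<^sub>E {..<4 * D})"
      by (intro finite_PiE) auto
    \<comment> \<open>Coordinates of vertices stay below \<open>3 * D\<close>; \<open>4 * D\<close>
      is the next power of two.\<close>
    show "card ({..<K} \<rightarrow>\<^sub>E {..<4 * D}) \<le> 2 ^ ((p + 2) * K)"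
    proof -
      have "4 * D = 2 ^ (p + 2)"
        by (simp add: D_def)
      then show ?thesis
        by (simp only: card_PiE finite_lessThan card_lessThan prod_constant power_mult)
    qed
    show "finite (?A \<times> S)"
      using fin by simp
    show "2 ^ ((2 * p - 1) * K) \<le> card (?A \<times> S)"
      unfolding exp power_add card_cartesian_product using S
      by (intro mult_mono) (auto simp: card_PiE D_def power_mult)
  next
    fix y
    assume "y \<in> ?A \<times> S"
    then obtain x a where xa: "y = (x, a)" "x \<in> ?A" "a \<in> ?A"
      by (auto simp: S_def)
    have "x l + k * a l < 4 * D" if "l < K" "k \<le> 2" for k l
    proof -
      have "x l < D" "a l < D"
        using xa that by (auto simp: PiE_iff)
      moreover have "k * a l \<le> 2 * a l"
        using that by simp
      ultimately show ?thesis
        by linarith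
    qed
    then show "mv 0 y \<in> {..<K} \<rightarrow>\<^sub>E {..<4 * D} \<and> mv 1 y \<in> {..<K} \<rightarrow>\<^sub>E {..<4 * D} \<and>
        mv 2 y \<in> {..<K} \<rightarrow>\<^sub>E {..<4 * D}"
      using xa by (force simp: mv_def)
  next
    fix y y' y''
    assume "y \<in> ?A \<times> S" "y' \<in> ?A \<times> S" "y'' \<in> ?A \<times> S"
      and eq: "mv 0 y = mv 0 y''" "mv 1 y = mv 1 y'" "mv 2 y' = mv 2 y''"
    then obtain x a x' b x'' c where y: "y = (x, a)" "y' = (x', b)" "y'' = (x'', c)"
      and A: "x \<in> ?A" "x' \<in> ?A" "x'' \<in> ?A" "a \<in> S" "b \<in> S" "c \<in> S"
      by auto
    have S: "(\<Sum>l<K. (a l)\<^sup>2) = r" "(\<Sum>l<K. (b l)\<^sup>2) = r" "(\<Sum>l<K. (c l)\<^sup>2) = r"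
      "a \<in> ?A" "b \<in> ?A" "c \<in> ?A"
      using A by (auto simp: S_def)
    have e: "x l = x'' l" "x l + a l = x' l + b l" "x' l + 2 * b l = x'' l + 2 * c l" if "l < K" for l
      using fun_cong[OF eq(1), of l] fun_cong[OF eq(2), of l] fun_cong[OF eq(3), of l] that
      by (simp_all add: mv_def y)
    \<comment> \<open>Since \<open>x = x''\<close>, the difference \<open>x' - x\<close> equals both
      \<open>a - b\<close> and \<open>2 * c - 2 * b\<close>.\<close>
    have mid: "a l + b l = 2 * c l" if "l < K" for l
      using e[OF that] by linarith
    have "a l = b l" if "l < K" for l
      using sphere_midpoint_unique[OF S(1-3) mid that] by simp
    then have "a l = b l \<and> b l = c l \<and> x l = x' l \<and> x' l = x'' l" if "l < K" for l
      using e[OF that] mid[OF that] that by fastforce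
    moreover have "u = v" if "u \<in> ?A" "v \<in> ?A" "\<And>l. l < K \<Longrightarrow> u l = v l" for u v
      using that by (intro PiE_ext[OF that(1,2)]) auto
    ultimately have "a = b \<and> b = c \<and> x = x' \<and> x' = x''"
      using A(1-3) S(4-6) by (metis (no_types))
    then show "y = y' \<and> y' = y''"
      by (simp add: y)
  qed
qed

section \<open>Comparison of the exponents\<close>

text \<open>For fixed \<open>p\<close>, powers of one Behrend restriction compare the costs along
  multiples of \<open>n\<close> and \<open>m\<close>, giving the factor
  \<open>(2 * p - 1) / (p + 2)\<close>. It tends to 2 as \<open>p\<close> grows.\<close>

lemma rel_exponent_unit_le_matmult:
  fixes t :: "('f::field, 'i, 'j, 'k) tensor3"
  shows "2 * rel_exponent t (unit_tensor 2) \<le> rel_exponent t (matmult_tensor 2 2 2)"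
proof -
  let ?U = "rel_exponent t (unit_tensor 2)" and ?M = "rel_exponent t (matmult_tensor 2 2 2)"
  let ?u = "\<lambda>n. ereal (1 / real n) * ereal_of_enat (power_cost t (unit_tensor 2) n)"
  let ?m = "\<lambda>n. ereal (1 / real n) * ereal_of_enat (power_cost t (matmult_tensor 2 2 2) n)"
  have U: "?u \<longlonglongrightarrow> ?U"
    by (rule rel_exponent_LIMSEQ[of _ 0 0 0]) (auto simp: unit_tensor_def finite_tensor_def)
  have M: "?m \<longlonglongrightarrow> ?M"
    by (rule rel_exponent_LIMSEQ[of _ "(0, 0)" "(0, 0)" "(0, 0)"])
      (auto simp: matmult_tensor_def finite_tensor_def)
  have bound: "ereal ((2 * real p - 1) / (real p + 2)) * ?U \<le> ?M" if "p \<ge> 1" for p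
  proof -
    \<comment> \<open>With \<open>p\<close> fixed, \<open>2 ^ K\<close> outgrows the linear
      pigeonhole loss.\<close>
    have "\<forall>\<^sub>F K in sequentially. real K * (2 ^ p)\<^sup>2 + 1 \<le> 2 ^ K"
      by real_asymp
    then obtain K where K: "K \<ge> 1" "real K * (2 ^ p)\<^sup>2 + 1 \<le> 2 ^ K"
      unfolding eventually_sequentially by (meson nle_le)
    have "real (K * (2 ^ p)\<^sup>2 + 1) \<le> real (2 ^ K)"
      using K(2) by simp
    then have "K * (2 ^ p)\<^sup>2 + 1 \<le> 2 ^ K"
      by (simp only: of_nat_le_iff)
    define m n where "m = (p + 2) * K" and "n = (2 * p - 1) * K"
    have "m > 0" "n > 0"
      using K(1) that by (auto simp: m_def n_def)
    have ratio: "real n / real m = (2 * real p - 1) / (real p + 2)"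
    proof -
      have "real n = (2 * real p - 1) * real K" "real m = (real p + 2) * real K"
        using that by (simp_all add: m_def n_def of_nat_diff algebra_simps)
      then show ?thesis
        using K(1) by simp
    qed
    have "restricts_to (tensor_power (matmult_tensor 2 2 2 :: ('f, _, _, _) tensor3) (m * k))
        (tensor_power (unit_tensor 2) (n * k))" for k
      unfolding m_def n_def
      by (intro restricts_to_power_mult matmult_power_restricts_to_unit_power_Behrend) fact+
    then have cost: "power_cost t (unit_tensor 2) (n * k) \<le> power_cost t (matmult_tensor 2 2 2) (m * k)" for k
      by (rule power_cost_anti)
    have le: "ereal (real n / real m) * ?u (n * k) \<le> ?m (m * k)" for k
    proof -
      have "real n / real m * (1 / real (n * k)) = 1 / real (m * k)"
        using \<open>n > 0\<close> by (simp add: field_simps)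
      then have "ereal (real n / real m) * ?u (n * k) =
          ereal (1 / real (m * k)) * ereal_of_enat (power_cost t (unit_tensor 2) (n * k))"
        by (simp flip: mult.assoc)
      also have "\<dots> \<le> ?m (m * k)"
        by (intro ereal_mult_left_mono) (use cost in auto)
      finally show ?thesis .
    qed
    have "strict_mono (\<lambda>k. n * k)" "strict_mono (\<lambda>k. m * k)"
      using \<open>m > 0\<close> \<open>n > 0\<close> by (auto simp: strict_mono_def)
    then have "(\<lambda>k. ?u (n * k)) \<longlonglongrightarrow> ?U" "(\<lambda>k. ?m (m * k)) \<longlonglongrightarrow> ?M"
      using LIMSEQ_subseq_LIMSEQ[OF U, of "\<lambda>k. n * k"] LIMSEQ_subseq_LIMSEQ[OF M, of "\<lambda>k. m * k"]
      unfolding o_def by blast+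
    then have "ereal (real n / real m) * ?U \<le> ?M"
      by (intro LIMSEQ_le[OF tendsto_cmult_ereal]) (use le in auto)
    then show ?thesis
      by (simp add: ratio)
  qed
  have U0: "0 \<le> ?U"
    by (rule LIMSEQ_le_const[OF U]) auto
  show ?thesis
  proof (cases ?U)
    case (real x)
    have "(\<lambda>p. (2 * real p - 1) / (real p + 2) * x) \<longlonglongrightarrow> 2 * x"
      by real_asymp
    then have "(\<lambda>p. ereal ((2 * real p - 1) / (real p + 2)) * ?U) \<longlonglongrightarrow> 2 * ?U"
      by (simp add: real)
    then show ?thesis
      by (rule LIMSEQ_le_const2) (use bound in auto)
  \<comment> \<open>If \<open>?U\<close> is infinite, the factor 1/3 at \<open>p = 1\<close> already
    forces \<open>?M\<close> to be infinite; \<open>U0\<close> excludes minus infinity.\<close>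
  qed (use bound[of 1] U0 in auto)
qed

theorem theorem3p1:
  fixes t :: "('f::field, 'i, 'j, 'k) tensor3"
  assumes "finite_tensor t" and "\<not> simple_tensor t"
  shows "rel_exponent (unit_tensor 2) t * rel_exponent t (matmult_tensor 2 2 2)
    \<ge> 2 * irreversibility t"
proof -
  \<comment> \<open>The zero tensor is simple, so \<open>t\<close> has a nonzero coefficient, as
    convergence requires.\<close>
  obtain i j k where "i \<in> idx1 t" "j \<in> idx2 t" "k \<in> idx3 t" "coeff t i j k \<noteq> 0"
  proof (rule ccontr)
    assume "\<not> thesis"
    then have "simple_tensor t"
      unfolding simple_tensor_def using that by (intro exI[of _ "\<lambda>_. 0"]) auto
    then show False
      using assms(2) by contradiction
  qed
  note lim = rel_exponent_LIMSEQ[OF assms(1) this]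
  \<comment> \<open>Nonnegativity permits multiplying the comparison by this factor in the extended
    reals.\<close>
  have "0 \<le> rel_exponent (unit_tensor 2) t"
    by (rule LIMSEQ_le_const[OF lim]) auto
  then have "rel_exponent (unit_tensor 2) t * (2 * rel_exponent t (unit_tensor 2)) \<le>
      rel_exponent (unit_tensor 2) t * rel_exponent t (matmult_tensor 2 2 2)"
    by (intro ereal_mult_left_mono rel_exponent_unit_le_matmult)
  then show ?thesis
    by (simp add: irreversibility_def mult_ac)
qed

end
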